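(* Let $X$ be a $T_1$ regular topological space, $x\in X$, and $\kappa$ an infinite cardinal. Suppose that $X$ is $\sigma$-$m_3$ at the point $x$ and that $c(U)\leq\kappa$ for some open neighborhood $U$ of $x$. Then $t(x,X)\leq\kappa$. In particular, if $X$ is a $\sigma$-$m_3$-space, then $t(X)\leq c(X)$.
   Context: A local pairbase at a point $x$ of $X$ is a family $\mathcal{P}$ of pairs $(P',P'')$ of subsets of $X$ such that (1) for every $(P',P'')\in\mathcal{P}$, $P'$ is open and $P'\subset P''$; (2) for every open $U\ni x$ there is $(P',P'')\in\mathcal{P}$ with $x\in P'\subset P''\subset U$. A family $\mathcal{P}$ of pairs is cushioned if for every $\mathcal{Q}\subset\mathcal{P}$, $\overline{\bigcup\{P':(P',P'')\in\mathcal{Q}\}}\subset\bigcup\{P'':(P',P'')\in\mathcal{Q}\}$. It is $\sigma$-cushioned if it is a countable union of cushioned families. $X$ is $\sigma$-$m_3$ at $x$ if it has a $\sigma$-cushioned local pairbase at $x$; $X$ is a $\sigma$-$m_3$-space if it is $\sigma$-$m_3$ at each of its points. Tightness: for an infinite cardinal $\kappa$, $t(x,X)\leq\kappa$ means that for every $A\subset X$ with $x\in\overline{A}$ there is $B\subset A$ with $|B|\leq\kappa$ and $x\in\overline{B}$; $t(X)\leq\kappa$ means $t(x,X)\leq\kappa$ for all $x\in X$. Cellularity: $c(X)=\sup\{|\mathcal{U}|:\mathcal{U}\text{ is a pairwise disjoint family of non-empty open subsets of }X\}+\omega$; $c(U)$ is the cellularity of the subspace $U$. *)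

theory Defs
  imports "HOL-Analysis.Analysis"
begin

unbundle cardinal_syntax

text \<open>Cardinals are relations \<open>r\<close> with \<^prop>\<open>Card_order r\<close>, compared by \<open>\<le>o\<close>.\<close>

subsection \<open>\<open>\<sigma>\<close>-\<open>m\<^sub>3\<close>-spaces\<close>

text \<open>A pair \<open>(P', P'')\<close> of subsets of the space is an element of type \<open>'a set \<times> 'a set\<close>.\<close>

definition local_pairbase :: "'a topology \<Rightarrow> 'a \<Rightarrow> ('a set \<times> 'a set) set \<Rightarrow> bool" where
  "local_pairbase X x \<P> \<longleftrightarrow>
     (\<forall>(P', P'') \<in> \<P>. openin X P' \<and> P' \<subseteq> P'' \<and> P'' \<subseteq> topspace X) \<and>
     (\<forall>U. openin X U \<and> x \<in> U \<longrightarrow> (\<exists>(P', P'') \<in> \<P>. x \<in> P' \<and> P' \<subseteq> P'' \<and> P'' \<subseteq> U))"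

definition cushioned :: "'a topology \<Rightarrow> ('a set \<times> 'a set) set \<Rightarrow> bool" where
  "cushioned X \<P> \<longleftrightarrow> (\<forall>\<Q> \<subseteq> \<P>. X closure_of (\<Union>(fst ` \<Q>)) \<subseteq> \<Union>(snd ` \<Q>))"

definition sigma_cushioned :: "'a topology \<Rightarrow> ('a set \<times> 'a set) set \<Rightarrow> bool" where
  "sigma_cushioned X \<P> \<longleftrightarrow> (\<exists>\<F>. countable \<F> \<and> (\<forall>\<C>\<in>\<F>. cushioned X \<C>) \<and> \<P> = \<Union>\<F>)"

definition sigma_m3_at :: "'a topology \<Rightarrow> 'a \<Rightarrow> bool" where
  "sigma_m3_at X x \<longleftrightarrow> (\<exists>\<P>. local_pairbase X x \<P> \<and> sigma_cushioned X \<P>)"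

definition sigma_m3_space :: "'a topology \<Rightarrow> bool" where
  "sigma_m3_space X \<longleftrightarrow> (\<forall>x \<in> topspace X. sigma_m3_at X x)"

subsection \<open>Tightness\<close>

definition tightness_at_le :: "'a topology \<Rightarrow> 'a \<Rightarrow> 'k rel \<Rightarrow> bool" where
  "tightness_at_le X x \<kappa> \<longleftrightarrow>
     (\<forall>A \<subseteq> topspace X. x \<in> X closure_of A \<longrightarrow> (\<exists>B \<subseteq> A. |B| \<le>o \<kappa> \<and> x \<in> X closure_of B))"

definition tightness_le :: "'a topology \<Rightarrow> 'k rel \<Rightarrow> bool" where
  "tightness_le X \<kappa> \<longleftrightarrow> (\<forall>x \<in> topspace X. tightness_at_le X x \<kappa>)"

subsection \<open>Cellularity\<close>

text \<open>
  The supremum of a set \<open>R\<close> of cardinals on a type \<open>'b\<close>, unique up to \<open>=o\<close>. It is enough to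
  look for it on \<open>'b\<close> itself, since \<^term>\<open>card_of (UNIV :: 'b set)\<close> is an upper bound of \<open>R\<close>
  and every cardinal below that one is represented on \<open>'b\<close>; see \<open>card_Sup_least\<close>.
\<close>

definition card_Sup :: "'b rel set \<Rightarrow> 'b rel" where
  "card_Sup R = (SOME s. Card_order s \<and> (\<forall>r\<in>R. r \<le>o s) \<and>
     (\<forall>s' :: 'b rel. Card_order s' \<and> (\<forall>r\<in>R. r \<le>o s') \<longrightarrow> s \<le>o s'))"

definition cellularity :: "'a topology \<Rightarrow> ('a set + nat) rel" where
  "cellularity X =
     card_Sup {|\<U>| | \<U>. (\<forall>U\<in>\<U>. openin X U \<and> U \<noteq> {}) \<and> pairwise disjnt \<U>} +c natLeq"

lemma card_Sup_props:
  fixes R :: "'b rel set"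
  assumes "\<And>r. r \<in> R \<Longrightarrow> Card_order r"
  shows "Card_order (card_Sup R)" "\<And>r. r \<in> R \<Longrightarrow> r \<le>o card_Sup R"
    "\<And>s' :: 'b rel. Card_order s' \<Longrightarrow> (\<And>r. r \<in> R \<Longrightarrow> r \<le>o s') \<Longrightarrow> card_Sup R \<le>o s'"
proof -
  let ?S = "{s :: 'b rel. Card_order s \<and> (\<forall>r\<in>R. r \<le>o s)}"
  have "r \<le>o |UNIV :: 'b set|" if "r \<in> R" for r
    using ordIso_ordLeq_trans[OF ordIso_symmetric[OF card_of_Field_ordIso[OF assms[OF that]]]
        card_of_mono1[OF subset_UNIV]] .
  then have "|UNIV :: 'b set| \<in> ?S" using card_of_Card_order by blast
  then have "\<exists>s\<in>?S. \<forall>s'\<in>?S. s \<le>o s'"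
    by (intro exists_minim_Card_order) auto
  then have "\<exists>s :: 'b rel. Card_order s \<and> (\<forall>r\<in>R. r \<le>o s) \<and>
     (\<forall>s' :: 'b rel. Card_order s' \<and> (\<forall>r\<in>R. r \<le>o s') \<longrightarrow> s \<le>o s')"
    by blast
  from someI_ex[OF this]
  have *: "Card_order (card_Sup R) \<and> (\<forall>r\<in>R. r \<le>o card_Sup R) \<and>
     (\<forall>s' :: 'b rel. Card_order s' \<and> (\<forall>r\<in>R. r \<le>o s') \<longrightarrow> card_Sup R \<le>o s')"
    unfolding card_Sup_def .
  show "Card_order (card_Sup R)" "\<And>r. r \<in> R \<Longrightarrow> r \<le>o card_Sup R"
    "\<And>s' :: 'b rel. Card_order s' \<Longrightarrow> (\<And>r. r \<in> R \<Longrightarrow> r \<le>o s') \<Longrightarrow> card_Sup R \<le>o s'"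
    using * by auto
qed

lemma card_Sup_least:
  fixes R :: "'b rel set" and s :: "'c rel"
  assumes R: "\<And>r. r \<in> R \<Longrightarrow> Card_order r" and s: "Card_order s"
    and ub: "\<And>r. r \<in> R \<Longrightarrow> r \<le>o s"
  shows "card_Sup R \<le>o s"
proof (cases "s \<le>o |UNIV :: 'b set|")
  case True
  then have "|Field s| \<le>o |UNIV :: 'b set|"
    using s card_of_Field_ordIso ordIso_ordLeq_trans by blast
  then obtain f :: "'c \<Rightarrow> 'b" where "inj_on f (Field s)"
    using card_of_ordLeq[of "Field s" "UNIV :: 'b set"] by auto
  then have "|f ` Field s| =o |Field s|"
    by (meson card_of_ordIso inj_on_imp_bij_betw ordIso_symmetric)
  then have iso: "|f ` Field s| =o s"
    using s card_of_Field_ordIso ordIso_transitive by blast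
  have "card_Sup R \<le>o |f ` Field s|"
    by (rule card_Sup_props(3)[OF R card_of_Card_order])
       (auto intro: ordLeq_ordIso_trans[OF ub ordIso_symmetric[OF iso]])
  then show ?thesis using iso ordLeq_ordIso_trans by blast
next
  case False
  then have "|UNIV :: 'b set| \<le>o s"
    using s by (meson card_of_Well_order card_order_on_def ordLeq_total)
  moreover have "card_Sup R \<le>o |UNIV :: 'b set|"
    using ordIso_ordLeq_trans[OF ordIso_symmetric[OF card_of_Field_ordIso[OF card_Sup_props(1)[OF R]]]
        card_of_mono1[OF subset_UNIV]] .
  ultimately show ?thesis using ordLeq_transitive by blast
qed

lemma Cinfinite_cellularity: "Cinfinite (cellularity X)"
  unfolding cellularity_def
  by (simp add: cinfinite_csum natLeq_cinfinite Card_order_csum)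

end

theory Submission
  imports Defs "HOL-Library.Countable_Set_Type"
begin

text \<open>
  Write the pairbase at \<open>x\<close> as a countable union of cushioned families \<open>\<C>\<close> and let \<open>x\<close> be in the
  closure of \<open>A\<close>. It suffices to find, for each \<open>\<C>\<close>, a set \<open>B \<subseteq> A\<close> with at most \<open>\<kappa>\<close> points that
  meets \<open>P''\<close> for every \<open>(P', P'') \<in> \<C>\<close> with \<open>x \<in> P'\<close>: the union of these countably many sets then
  meets every neighbourhood of \<open>x\<close>.

  Cushionedness turns the choice of \<open>B\<close> into a question about open sets. For \<open>y \<in> A\<close> let \<open>V y\<close> be the
  complement of the closure of the union of those \<open>P'\<close> for which \<open>y \<notin> P''\<close>. This closure
  lies in the union of the corresponding \<open>P''\<close>, none of which contains \<open>y\<close>, so \<open>V y\<close> is an open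
  neighbourhood of \<open>y\<close>; and if \<open>V y\<close> meets some \<open>P'\<close>, then \<open>y \<in> P''\<close>. Inside \<open>U\<close>, where the cellularity is
  at most \<open>\<kappa>\<close>, the union of all the \<open>V y\<close> is contained in the closure of the union of only \<open>\<kappa>\<close> of them
  (\<open>dense_subunion_of_cellularity_le\<close>); let \<open>B\<close> consist of the corresponding points. If \<open>x \<in> P'\<close>, then
  \<open>P' \<inter> U\<close> contains a point \<open>y\<close> of \<open>A\<close>, so it meets \<open>V y\<close> and hence, being open, it meets \<open>V z\<close> for
  some \<open>z \<in> B\<close>. Therefore \<open>z \<in> P''\<close> (\<open>cushioned_hitting_set\<close>).
\<close>

lemma card_of_disjoint_opens_le_cellularity:
  assumes "\<And>W. W \<in> \<U> \<Longrightarrow> openin X W" and "\<And>W. W \<in> \<U> \<Longrightarrow> W \<noteq> {}" and "pairwise disjnt \<U>"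
  shows "|\<U>| \<le>o cellularity X"
proof -
  let ?R = "{|\<U>| | \<U>. (\<forall>U\<in>\<U>. openin X U \<and> U \<noteq> {}) \<and> pairwise disjnt \<U>}"
  have R: "\<And>r. r \<in> ?R \<Longrightarrow> Card_order r"
    by (auto simp: card_of_Card_order)
  have "|\<U>| \<le>o card_Sup ?R"
    using assms by (intro card_Sup_props(2)[OF R]) auto
  moreover have "card_Sup ?R \<le>o card_Sup ?R +c natLeq"
    by (intro ordLeq_csum1 card_Sup_props(1)[OF R])
  ultimately show ?thesis
    unfolding cellularity_def by (rule ordLeq_transitive)
qed

text \<open>
  Take a maximal disjoint family \<open>\<U>\<close> of non-empty open sets each contained in some \<open>V i\<close>. By
  maximality every open set that meets some \<open>V i\<close> meets a member of \<open>\<U>\<close>. As \<open>\<U>\<close> has at most \<open>\<kappa>\<close>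
  members, choosing one index for each of them yields \<open>J\<close>.
\<close>
lemma dense_subunion_of_cellularity_le:
  assumes V: "\<And>i. i \<in> I \<Longrightarrow> openin X (V i)" and c: "cellularity X \<le>o \<kappa>"
  obtains J where "J \<subseteq> I" "|J| \<le>o \<kappa>" "(\<Union>i\<in>I. V i) \<subseteq> X closure_of (\<Union>j\<in>J. V j)"
proof -
  let ?refines = "\<lambda>W. openin X W \<and> W \<noteq> {} \<and> (\<exists>i\<in>I. W \<subseteq> V i)"
  define \<D> where "\<D> = {\<U>. (\<forall>W\<in>\<U>. ?refines W) \<and> pairwise disjnt \<U>}"
  have "\<Union>\<C> \<in> \<D>" if "subset.chain \<D> \<C>" for \<C>
  proof -
    have "chain\<^sub>\<subseteq> \<C>" "\<C> \<subseteq> \<D>"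
      using that by (auto simp: subset_chain_def chain_subset_def)
    then show ?thesis
      by (auto simp: \<D>_def intro!: pairwise_chain_Union)
  qed
  from subset_Zorn'[OF this]
  obtain \<U> where "\<U> \<in> \<D>" and max: "\<And>\<U>'. \<U>' \<in> \<D> \<Longrightarrow> \<U> \<subseteq> \<U>' \<Longrightarrow> \<U>' = \<U>"
    by blast
  then have refines: "\<And>W. W \<in> \<U> \<Longrightarrow> ?refines W" and disj: "pairwise disjnt \<U>"
    by (auto simp: \<D>_def)
  from refines obtain f where f: "\<And>W. W \<in> \<U> \<Longrightarrow> f W \<in> I \<and> W \<subseteq> V (f W)"
    by metis
  have "|\<U>| \<le>o \<kappa>"
    using card_of_disjoint_opens_le_cellularity[of \<U> X] refines disj c ordLeq_transitive by blast
  then have "|f ` \<U>| \<le>o \<kappa>"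
    using card_of_image ordLeq_transitive by blast
  moreover have "(\<Union>i\<in>I. V i) \<subseteq> X closure_of (\<Union>j\<in>f ` \<U>. V j)"
  proof
    fix y assume "y \<in> (\<Union>i\<in>I. V i)"
    then obtain i where i: "i \<in> I" "y \<in> V i" by blast
    have "\<exists>z. z \<in> (\<Union>j\<in>f ` \<U>. V j) \<and> z \<in> G" if G: "openin X G" "y \<in> G" for G
    proof (rule ccontr)
      assume none: "\<not> ?thesis"
      have missed: "disjnt (G \<inter> V i) W" if "W \<in> \<U>" for W
        using none f[OF that] that by (fastforce simp: disjnt_def)
      have "?refines (G \<inter> V i)"
        using G i V by blast
      then have "insert (G \<inter> V i) \<U> \<in> \<D>"
        using refines disj missed by (auto simp: \<D>_def pairwise_insert dest: disjnt_sym)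
      then have "G \<inter> V i \<in> \<U>"
        using max by blast
      then show False
        using missed[of "G \<inter> V i"] G i by (auto simp: disjnt_def)
    qed
    moreover have "y \<in> topspace X"
      using i V openin_subset by blast
    ultimately show "y \<in> X closure_of (\<Union>j\<in>f ` \<U>. V j)"
      by (auto simp: in_closure_of)
  qed
  ultimately show ?thesis
    using f by (intro that[of "f ` \<U>"]) auto
qed

text \<open>
  The pairs are those whose first component meets \<open>A\<close> inside \<open>U\<close>, but \<open>B\<close> need only meet the second.
  This is where having two components matters: the points \<open>z \<in> B\<close> are only known to have
  neighbourhoods \<open>V z\<close> that meet \<open>P'\<close>, and the choice of \<open>V z\<close> places such points in \<open>P''\<close>, not in \<open>P'\<close>.
\<close>
lemma cushioned_hitting_set:
  assumes \<C>: "cushioned X \<C>" and op: "\<And>P. P \<in> \<C> \<Longrightarrow> openin X (fst P)"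
    and U: "openin X U" and c: "cellularity (subtopology X U) \<le>o \<kappa>"
  obtains B where "B \<subseteq> A" "|B| \<le>o \<kappa>" "\<And>P. P \<in> \<C> \<Longrightarrow> fst P \<inter> U \<inter> A \<noteq> {} \<Longrightarrow> snd P \<inter> B \<noteq> {}"
proof -
  define V where
    "V y = U - X closure_of (\<Union>(fst ` {P \<in> \<C>. y \<notin> snd P}))" for y
  have V_open: "openin (subtopology X U) (V y)" for y
    using U by (auto simp: V_def openin_open_subtopology)
  have V_self: "y \<in> V y" if "y \<in> U" for y
  proof -
    have "X closure_of (\<Union>(fst ` {P \<in> \<C>. y \<notin> snd P})) \<subseteq> \<Union>(snd ` {P \<in> \<C>. y \<notin> snd P})"
      using \<C>[unfolded cushioned_def, rule_format, of "{P \<in> \<C>. y \<notin> snd P}"] by simp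
    then show ?thesis
      using that by (auto simp: V_def)
  qed
  have V_meets: "y \<in> snd P" if "P \<in> \<C>" "fst P \<inter> V y \<noteq> {}" for y P
  proof (rule ccontr)
    assume "y \<notin> snd P"
    then have "fst P \<subseteq> X closure_of (\<Union>(fst ` {P \<in> \<C>. y \<notin> snd P}))"
      using that op[THEN openin_subset] by (intro closure_of_subset[THEN subset_trans[rotated]]) auto
    then show False
      using that by (auto simp: V_def)
  qed
  obtain B where B: "B \<subseteq> A \<inter> U" "|B| \<le>o \<kappa>"
    and dense: "(\<Union>y\<in>A \<inter> U. V y) \<subseteq> subtopology X U closure_of (\<Union>z\<in>B. V z)"
    using dense_subunion_of_cellularity_le[of "A \<inter> U" "subtopology X U" V, OF V_open c] by blast
  have "snd P \<inter> B \<noteq> {}" if P: "P \<in> \<C>" and "fst P \<inter> U \<inter> A \<noteq> {}" for P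
  proof -
    from that obtain y where y: "y \<in> fst P" "y \<in> U" "y \<in> A" by blast
    then have "y \<in> subtopology X U closure_of (\<Union>z\<in>B. V z)"
      using dense V_self by blast
    moreover have "openin (subtopology X U) (fst P \<inter> U)"
      using op[OF P] by (auto simp: openin_subtopology)
    ultimately obtain w where "w \<in> (\<Union>z\<in>B. V z)" "w \<in> fst P \<inter> U"
      using y unfolding in_closure_of by blast
    then obtain z where "z \<in> B" "fst P \<inter> V z \<noteq> {}"
      by blast
    then show ?thesis
      using V_meets[OF P] by blast
  qed
  with B show ?thesis
    using that[of B] by blast
qed

lemma tightness_at_le_if_sigma_m3_at:
  assumes \<kappa>: "Cinfinite \<kappa>" and m3: "sigma_m3_at X x"
    and U: "openin X U" "x \<in> U" and c: "cellularity (subtopology X U) \<le>o \<kappa>"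
  shows "tightness_at_le X x \<kappa>"
  unfolding tightness_at_le_def
proof (intro allI impI)
  fix A assume "A \<subseteq> topspace X" and x: "x \<in> X closure_of A"
  from m3 obtain \<P> \<F> where \<P>: "local_pairbase X x \<P>" and \<F>: "countable \<F>" "\<P> = \<Union>\<F>"
    and cush: "\<And>\<C>. \<C> \<in> \<F> \<Longrightarrow> cushioned X \<C>"
    by (auto simp: sigma_m3_at_def sigma_cushioned_def)
  have op: "openin X (fst P)" if "P \<in> \<P>" for P
    using \<P> that by (fastforce simp: local_pairbase_def)
  have "\<exists>B \<subseteq> A. |B| \<le>o \<kappa> \<and> (\<forall>P\<in>\<C>. fst P \<inter> U \<inter> A \<noteq> {} \<longrightarrow> snd P \<inter> B \<noteq> {})" if "\<C> \<in> \<F>" for \<C>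
  proof -
    have "openin X (fst P)" if "P \<in> \<C>" for P
      using op that \<open>\<C> \<in> \<F>\<close> \<F>(2) by blast
    from cushioned_hitting_set[OF cush[OF that] this U(1) c, of A]
    show ?thesis by metis
  qed
  then obtain B where B: "\<And>\<C>. \<C> \<in> \<F> \<Longrightarrow> B \<C> \<subseteq> A" "\<And>\<C>. \<C> \<in> \<F> \<Longrightarrow> |B \<C>| \<le>o \<kappa>"
    and hits: "\<And>\<C> P. \<C> \<in> \<F> \<Longrightarrow> P \<in> \<C> \<Longrightarrow> fst P \<inter> U \<inter> A \<noteq> {} \<Longrightarrow> snd P \<inter> B \<C> \<noteq> {}"
    by metis
  have "|\<F>| \<le>o natLeq"
    using \<F>(1) countable_card_le_natLeq by blast
  then have "|\<F>| \<le>o \<kappa>"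
    using \<kappa> natLeq_ordLeq_cinfinite ordLeq_transitive by blast
  then have "|\<Union>\<C>\<in>\<F>. B \<C>| \<le>o \<kappa>"
    using \<kappa> B(2) by (intro card_of_UNION_ordLeq_infinite_Field) (auto simp: cinfinite_def)
  moreover have "x \<in> X closure_of (\<Union>\<C>\<in>\<F>. B \<C>)"
    unfolding in_closure_of
  proof (intro conjI allI impI)
    show "x \<in> topspace X"
      using x by (simp add: in_closure_of)
    fix G assume "x \<in> G \<and> openin X G"
    then have "\<exists>(P', P'') \<in> \<P>. x \<in> P' \<and> P' \<subseteq> P'' \<and> P'' \<subseteq> G"
      using \<P> unfolding local_pairbase_def by blast
    then obtain P where P: "P \<in> \<P>" "x \<in> fst P" "snd P \<subseteq> G"
      by force
    have "openin X (fst P \<inter> U)" "x \<in> fst P \<inter> U"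
      using op[OF P(1)] P(2) U by auto
    then have "fst P \<inter> U \<inter> A \<noteq> {}"
      using x unfolding in_closure_of by blast
    then show "\<exists>y. y \<in> (\<Union>\<C>\<in>\<F>. B \<C>) \<and> y \<in> G"
      using hits P \<F>(2) by blast
  qed
  ultimately show "\<exists>B \<subseteq> A. |B| \<le>o \<kappa> \<and> x \<in> X closure_of B"
    using B(1) by blast
qed

theorem theorem5p4:
  fixes X :: "'a topology"
  assumes "t1_space X" and "regular_space X"
  shows "(\<forall>x \<in> topspace X. \<forall>\<kappa> :: 'k rel.
            Cinfinite \<kappa> \<and> sigma_m3_at X x \<and>
            (\<exists>U. openin X U \<and> x \<in> U \<and> cellularity (subtopology X U) \<le>o \<kappa>)
            \<longrightarrow> tightness_at_le X x \<kappa>) \<and>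
         (sigma_m3_space X \<longrightarrow> tightness_le X (cellularity X))"
proof (intro conjI ballI allI impI)
  fix x and \<kappa> :: "'k rel"
  assume *: "Cinfinite \<kappa> \<and> sigma_m3_at X x \<and>
    (\<exists>U. openin X U \<and> x \<in> U \<and> cellularity (subtopology X U) \<le>o \<kappa>)"
  then obtain U where "openin X U" "x \<in> U" "cellularity (subtopology X U) \<le>o \<kappa>"
    by (elim conjE exE)
  with * show "tightness_at_le X x \<kappa>"
    by (intro tightness_at_le_if_sigma_m3_at[of \<kappa> X x U]) simp_all
next
  assume m3: "sigma_m3_space X"
  have "Card_order (cellularity X)"
    using Cinfinite_cellularity by (rule conjunct2)
  then have "cellularity (subtopology X (topspace X)) \<le>o cellularity X"
    unfolding subtopology_topspace by (rule ordLeq_refl)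
  then have "tightness_at_le X x (cellularity X)" if "x \<in> topspace X" for x
    using m3 that unfolding sigma_m3_space_def
    by (intro tightness_at_le_if_sigma_m3_at[OF Cinfinite_cellularity _ openin_topspace]) simp_all
  then show "tightness_le X (cellularity X)"
    by (simp add: tightness_le_def)
qed

end
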